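(* Assume (A) and $\mathbf p=\mathbf u$. Then $$n\begin{pmatrix}H(\hat{\mathbf p})-\log m!\\ D(\hat{\mathbf p})\end{pmatrix}\xrightarrow{d}\begin{pmatrix}-\frac{m!}{2}\\[2pt] \frac{m!}{8}\end{pmatrix}Q_m.$$
   Context: Setting: $m\ge2$; $(\Pi_t)$ is the stationary series of ordinal patterns of length $m$ of an underlying process, with values in the $m!$ OPs $\pi_1,\dots,\pi_{m!}$; $\mathbf p=(p_1,\dots,p_{m!})$, $p_i=\mathbb P(\Pi_0=\pi_i)$; $\hat{\mathbf p}$ is the vector of relative frequencies $\hat p_i=\frac1n\sum_{t=1}^n\mathbb 1\{\Pi_t=\pi_i\}$; $p_{ij}(k)=\mathbb P(\Pi_0=\pi_i,\Pi_k=\pi_j)$; $\Sigma=(\sigma_{ij})$ with $\sigma_{ij}=p_i(\delta_{ij}-p_j)+\sum_{k=1}^\infty(p_{ij}(k)+p_{ji}(k)-2p_ip_j)$ (absolutely convergent). Standing assumption (A): $\sqrt n(\hat{\mathbf p}-\mathbf p)\xrightarrow{d}N(\mathbf 0,\Sigma)$. $\mathbf u=(1/m!,\dots,1/m!)$. Shannon entropy $H(\mathbf p)=-\sum_k p_k\log p_k$ with $0\log0:=0$; disequilibrium $D(\mathbf p)=H((\mathbf p+\mathbf u)/2)-\frac12H(\mathbf p)-\frac12\log m!$. $Q_m=\sum_{i=1}^l\lambda_i\chi^2_{r_i}$, where $\lambda_1,\dots,\lambda_l$ are the distinct nonzero eigenvalues of $\Sigma$ with algebraic multiplicities $r_1,\dots,r_l$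 and $\chi^2_{r_1},\dots,\chi^2_{r_l}$ are independent chi-square random variables with $r_i$ degrees of freedom. *)

theory Defs
  imports "HOL-Probability.Probability" "HOL-Computational_Algebra.Polynomial"
begin

text \<open>The ordinal pattern of length m of (x 0, ..., x (m-1)) is the list of indices
  [r_0, ..., r_(m-1)] sorting the values increasingly, x r_0 <= ... <= x r_(m-1);
  ties are broken by the index (stable sort).\<close>
definition ordpat :: "nat \<Rightarrow> (nat \<Rightarrow> real) \<Rightarrow> nat list" where
  "ordpat m x = sort_key x [0..<m]"

definition OPs :: "nat \<Rightarrow> nat list set" where
  "OPs m = {xs. distinct xs \<and> set xs = {0..<m}}"

definition OPseq :: "nat \<Rightarrow> (nat \<Rightarrow> 'a \<Rightarrow> real) \<Rightarrow> nat \<Rightarrow> 'a \<Rightarrow> nat list" where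
  "OPseq m X t \<omega> = ordpat m (\<lambda>i. X (t + i) \<omega>)"

text \<open>Strict stationarity of a discrete-valued sequence of random variables.\<close>
definition stationary_seq :: "'a measure \<Rightarrow> (nat \<Rightarrow> 'a \<Rightarrow> 'b) \<Rightarrow> bool" where
  "stationary_seq M Y \<longleftrightarrow> (\<forall>s k (a :: nat \<Rightarrow> 'b).
      measure M {\<omega>\<in>space M. \<forall>j<k. Y (s + j) \<omega> = a j}
    = measure M {\<omega>\<in>space M. \<forall>j<k. Y j \<omega> = a j})"

text \<open>The OPs are labelled pi_i = pat i, i ranging over the finite index type 'd.\<close>

definition op_prob :: "'a measure \<Rightarrow> nat \<Rightarrow> (nat \<Rightarrow> 'a \<Rightarrow> real) \<Rightarrow> nat list \<Rightarrow> real" where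
  "op_prob M m X \<pi> = measure M {\<omega>\<in>space M. OPseq m X 0 \<omega> = \<pi>}"

definition op_prob2 :: "'a measure \<Rightarrow> nat \<Rightarrow> (nat \<Rightarrow> 'a \<Rightarrow> real) \<Rightarrow> nat list \<Rightarrow> nat list \<Rightarrow> nat \<Rightarrow> real" where
  "op_prob2 M m X \<pi> \<rho> k = measure M {\<omega>\<in>space M. OPseq m X 0 \<omega> = \<pi> \<and> OPseq m X k \<omega> = \<rho>}"

definition pvec :: "'a measure \<Rightarrow> nat \<Rightarrow> (nat \<Rightarrow> 'a \<Rightarrow> real) \<Rightarrow> ('d::finite \<Rightarrow> nat list) \<Rightarrow> real ^ 'd" where
  "pvec M m X pat = (\<chi> i. op_prob M m X (pat i))"

definition phat :: "nat \<Rightarrow> (nat \<Rightarrow> 'a \<Rightarrow> real) \<Rightarrow> ('d::finite \<Rightarrow> nat list) \<Rightarrow> nat \<Rightarrow> 'a \<Rightarrow> real ^ 'd" where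
  "phat m X pat n \<omega> = (\<chi> i. (\<Sum>t\<in>{1..n}. if OPseq m X t \<omega> = pat i then 1 else 0) / real n)"

definition sigma_term :: "'a measure \<Rightarrow> nat \<Rightarrow> (nat \<Rightarrow> 'a \<Rightarrow> real) \<Rightarrow> nat list \<Rightarrow> nat list \<Rightarrow> nat \<Rightarrow> real" where
  "sigma_term M m X \<pi> \<rho> k = op_prob2 M m X \<pi> \<rho> k + op_prob2 M m X \<rho> \<pi> k
      - 2 * op_prob M m X \<pi> * op_prob M m X \<rho>"

definition Sigma_mat :: "'a measure \<Rightarrow> nat \<Rightarrow> (nat \<Rightarrow> 'a \<Rightarrow> real) \<Rightarrow> ('d::finite \<Rightarrow> nat list) \<Rightarrow> real ^ 'd ^ 'd" where
  "Sigma_mat M m X pat = (\<chi> i j.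
      op_prob M m X (pat i) * ((if i = j then 1 else 0) - op_prob M m X (pat j))
      + (\<Sum>k. sigma_term M m X (pat i) (pat j) (Suc k)))"

definition shannon :: "real ^ 'd::finite \<Rightarrow> real" where
  "shannon q = - (\<Sum>k\<in>UNIV. if q $ k = 0 then 0 else q $ k * ln (q $ k))"

definition unif :: "nat \<Rightarrow> real ^ 'd::finite" where
  "unif m = (\<chi> i. 1 / fact m)"

definition diseq :: "nat \<Rightarrow> real ^ 'd::finite \<Rightarrow> real" where
  "diseq m q = shannon ((1/2) *\<^sub>R (q + unif m)) - shannon q / 2 - ln (fact m) / 2"

definition conv_distr :: "'a measure \<Rightarrow> (nat \<Rightarrow> 'a \<Rightarrow> 'b::topological_space) \<Rightarrow> 'b measure \<Rightarrow> bool" where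
  "conv_distr M Y \<mu> \<longleftrightarrow> (\<forall>f :: 'b \<Rightarrow> real. continuous_on UNIV f \<longrightarrow> bounded (range f) \<longrightarrow>
      ((\<lambda>n. \<integral>\<omega>. f (Y n \<omega>) \<partial>M) \<longlonglongrightarrow> (\<integral>x. f x \<partial>\<mu>)))"

text \<open>Centered multivariate normal law N(0, S) (possibly singular), via its characteristic function.\<close>
definition centered_normal :: "real ^ 'd::finite ^ 'd \<Rightarrow> (real ^ 'd) measure \<Rightarrow> bool" where
  "centered_normal S \<mu> \<longleftrightarrow> prob_space \<mu> \<and> sets \<mu> = sets borel \<and>
     (\<forall>t. (\<integral>x. cis (t \<bullet> x) \<partial>\<mu>) = complex_of_real (exp (- (t \<bullet> (S *v t)) / 2)))"

definition charpoly :: "real ^ 'd::finite ^ 'd \<Rightarrow> real poly" where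
  "charpoly A = det (\<chi> i j. (if i = j then [:0, 1:] else 0) - [:A $ i $ j:])"

definition chi2_density :: "nat \<Rightarrow> real \<Rightarrow> real" where
  "chi2_density r x = (if x > 0 then x powr (real r / 2 - 1) * exp (- x / 2)
      / (2 powr (real r / 2) * Gamma (real r / 2)) else 0)"

text \<open>Law of Q = sum_i lambda_i chi2_{r_i}: lambda_i the distinct nonzero eigenvalues of A,
  r_i their algebraic multiplicities, chi-squares independent.\<close>
definition Q_law :: "real ^ 'd::finite ^ 'd \<Rightarrow> real measure" where
  "Q_law A = (let \<Lambda> = {l. l \<noteq> 0 \<and> poly (charpoly A) l = 0} in
     distr (PiM \<Lambda> (\<lambda>l. density lborel (chi2_density (order l (charpoly A)))))
       borel (\<lambda>c. \<Sum>l\<in>\<Lambda>. l * c l))"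

end

theory Submission
  imports Defs "HOL-Real_Asymp.Real_Asymp"
begin

text \<open>
  Around the uniform vector, \<open>H(q) - log m!\<close> equals \<open>- m!/2 * |q - u|\<^sup>2\<close> and \<open>D(q)\<close> equals
  \<open>m!/8 * |q - u|\<^sup>2\<close> up to \<open>o(|q - u|\<^sup>2)\<close>, since the coordinates of \<open>q - u\<close> sum to zero. By a Slutsky
  argument the limit law is therefore the image of the law of \<open>|G|\<^sup>2\<close>, where \<open>G\<close> is centered normal with
  covariance \<open>\<Sigma>\<close>. To identify \<open>|G|\<^sup>2\<close> with \<open>Q\<close>, both Laplace transforms are computed in an eigenbasis of
  \<open>\<Sigma>\<close>, and a law on the nonnegative reals is determined by its Laplace transform at the integers, by
  Weierstrass approximation in the variable \<open>exp (- q)\<close>.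
\<close>

section \<open>Spectral decomposition of symmetric matrices\<close>

text \<open>For small \<open>t\<close> the linear term dominates, so a nonzero \<open>a\<close>
  would force a negative value. This replaces differentiation as the first-order condition for a
  maximum of a quadratic form.\<close>

lemma quadratic_nonneg_imp_linear_zero:
  fixes a b :: real
  assumes "\<And>t. 0 \<le> 2 * t * a + t\<^sup>2 * b"
  shows "a = 0"
proof (rule ccontr)
  assume a: "a \<noteq> 0"
  have b: "0 \<le> b" using assms[of 1] assms[of "-1"] by simp
  \<comment> \<open>The denominator \<open>b+1\<close> is positive even for \<open>b = 0\<close>.
    For this \<open>t\<close> the expression becomes \<open>t * a - t^2\<close>, where
    \<open>t * a\<close> is negative.\<close>
  define t where "t = - a / (b+1)"
  have t: "t * (b+1) = - a" using b by (simp add: t_def)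
  have "2 * t * a + t\<^sup>2 * b = t * (t * (b+1)) + 2 * t * a - t\<^sup>2" by (simp add: algebra_simps power2_eq_square)
  also have "\<dots> = t * a - t\<^sup>2" by (simp add: t)
  also have "t * a = - (a * a) / (b + 1)" by (simp add: t_def)
  also have "\<dots> - t\<^sup>2 < 0" using a b by (smt (verit) divide_neg_pos not_real_square_gt_zero zero_le_power2)
  finally show False using assms[of t] by simp
qed

text \<open>Variational argument: \<open>x \<bullet> f x\<close> attains its maximum
  \<open>c\<close> on the compact unit sphere of \<open>W\<close>, and a maximizer \<open>v\<close>
  satisfies the first-order condition \<open>f v = c v\<close>.\<close>

lemma selfadjoint_eigenvector:
  fixes f :: "'a::euclidean_space \<Rightarrow> 'a"
  assumes lin: "linear f" and sym: "\<And>x y. f x \<bullet> y = x \<bullet> f y"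
    and W: "subspace W" and inv: "\<And>x. x \<in> W \<Longrightarrow> f x \<in> W" and nz: "W \<noteq> {0}"
  shows "\<exists>v\<in>W. norm v = 1 \<and> (\<exists>c. f v = c *\<^sub>R v)"
proof -
  let ?K = "W \<inter> sphere 0 1"
  obtain z where z: "z \<in> W" "z \<noteq> 0" using nz W subspace_0 by blast
  have "(1 / norm z) *\<^sub>R z \<in> ?K" using z W by (simp add: subspace_scale)
  then have ne: "?K \<noteq> {}" by blast
  have comp: "compact ?K" using closed_subspace[OF W] by (simp add: closed_Int_compact)
  have cont: "continuous_on ?K (\<lambda>x. x \<bullet> f x)"
    by (intro continuous_intros linear_continuous_on linear_conv_bounded_linear[THEN iffD1] lin)
  obtain v where v: "v \<in> ?K" and vmax: "\<And>x. x \<in> ?K \<Longrightarrow> x \<bullet> f x \<le> v \<bullet> f v"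
    using continuous_attains_sup[OF comp ne cont] by blast
  define c where "c = v \<bullet> f v"
  have vW: "v \<in> W" and vv: "v \<bullet> v = 1" using v by (auto simp: norm_eq_1)
  \<comment> \<open>Homogeneity extends maximality from the unit sphere to all of
    \<open>W\<close>.\<close>
  have bound: "x \<bullet> f x \<le> c * (x \<bullet> x)" if x: "x \<in> W" for x
  proof (cases "x = 0")
    case False
    have "(1 / norm x) *\<^sub>R x \<in> ?K" using False x W by (simp add: subspace_scale)
    from vmax[OF this] have "(x \<bullet> f x) / (norm x)\<^sup>2 \<le> c"
      by (simp add: c_def linear_scale[OF lin] power2_eq_square)
    then show ?thesis using False by (simp add: field_simps power2_norm_eq_inner)
  qed simp
  \<comment> \<open>The form \<open>c |x|^2 - x \<bullet> f x\<close> is nonnegative on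
    \<open>W\<close> and vanishes at \<open>v\<close>. Moving from \<open>v\<close> in the direction
    \<open>w\<close> itself makes the coefficient of \<open>2 * t\<close> equal to
    \<open>w \<bullet> w\<close>, which must therefore be zero.\<close>
  define w where "w = c *\<^sub>R v - f v"
  have w: "w \<in> W" using vW W inv by (simp add: w_def subspace_diff subspace_scale)
  have "0 \<le> 2 * t * (w \<bullet> w) + t\<^sup>2 * (c * (w \<bullet> w) - w \<bullet> f w)" for t
  proof -
    have "v + t *\<^sub>R w \<in> W" using vW w W by (simp add: subspace_add subspace_scale)
    from bound[OF this]
    have "0 \<le> c * ((v + t *\<^sub>R w) \<bullet> (v + t *\<^sub>R w)) - (v + t *\<^sub>R w) \<bullet> (f v + t *\<^sub>R f w)"
      by (simp add: linear_add[OF lin] linear_scale[OF lin])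
    also have "\<dots> = c * (v \<bullet> v) - v \<bullet> f v + 2 * t * (c * (v \<bullet> w) - f v \<bullet> w) + t\<^sup>2 * (c * (w \<bullet> w) - w \<bullet> f w)"
      using sym[of v w]
      by (simp add: inner_add_left inner_add_right inner_commute algebra_simps power2_eq_square)
    also have "c * (v \<bullet> w) - f v \<bullet> w = w \<bullet> w"
      by (subst (3) w_def) (simp add: inner_diff_left)
    finally show ?thesis using vv by (simp add: c_def)
  qed
  then have "w \<bullet> w = 0" by (rule quadratic_nonneg_imp_linear_zero)
  then have "f v = c *\<^sub>R v" by (simp add: w_def)
  then show ?thesis using vW vv by (auto simp: norm_eq_1)
qed

text \<open>Take an orthonormal set of eigenvectors of greatest cardinality. Its orthogonal
  complement is invariant by self-adjointness, so a nonzero complement would contain a further unit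
  eigenvector.\<close>

lemma selfadjoint_orthonormal_eigenbasis:
  fixes f :: "'a::euclidean_space \<Rightarrow> 'a"
  assumes lin: "linear f" and sym: "\<And>x y. f x \<bullet> y = x \<bullet> f y"
  obtains B where "pairwise orthogonal B" "\<And>v. v \<in> B \<Longrightarrow> norm v = 1"
    "\<And>v. v \<in> B \<Longrightarrow> \<exists>c. f v = c *\<^sub>R v" "independent B" "span B = UNIV"
proof -
  define P where "P B \<longleftrightarrow> pairwise orthogonal B \<and> (\<forall>v\<in>B. norm v = 1 \<and> (\<exists>c. f v = c *\<^sub>R v))" for B
  have ind: "independent B" if "P B" for B
    using that by (intro pairwise_orthogonal_independent) (auto simp: P_def)
  have "P {}" by (simp add: P_def)
  \<comment> \<open>Orthonormal sets are independent, so the dimension bounds their cardinality and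
    a greatest one exists.\<close>
  moreover have "\<forall>B. P B \<longrightarrow> card B < Suc DIM('a)"
    using ind independent_bound by (metis less_Suc_eq_le)
  ultimately obtain B where B: "P B" and Bmax: "\<And>C. P C \<Longrightarrow> card C \<le> card B"
    using ex_has_greatest_nat[of P "{}" card "Suc DIM('a)"] by blast
  have fin: "finite B" using ind[OF B] independent_bound by blast
  define U where "U = {x. \<forall>y\<in>B. y \<bullet> x = 0}"
  have U: "subspace U" by (auto simp: U_def subspace_def inner_add_right)
  have inv: "f x \<in> U" if x: "x \<in> U" for x
  proof -
    have "y \<bullet> f x = 0" if y: "y \<in> B" for y
    proof -
      obtain c where "f y = c *\<^sub>R y" using B y by (auto simp: P_def)
      then show ?thesis using sym[of y x] x y by (simp add: U_def)
    qed
    then show ?thesis by (simp add: U_def)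
  qed
  have "U = {0}"
  proof (rule ccontr)
    assume "U \<noteq> {0}"
    from selfadjoint_eigenvector[OF lin sym U inv this]
    obtain v where v: "v \<in> U" "norm v = 1" "\<exists>c. f v = c *\<^sub>R v" by blast
    have "v \<notin> B" using v by (auto simp: U_def norm_eq_1)
    moreover have "P (insert v B)"
      using B v by (auto simp: P_def pairwise_insert orthogonal_def U_def inner_commute)
    ultimately show False using Bmax[of "insert v B"] fin by simp
  qed
  have "span B = UNIV"
  proof (rule ccontr)
    assume "span B \<noteq> UNIV"
    then have "span B \<subset> span UNIV" by auto
    then obtain x where "x \<noteq> 0" "\<And>y. y \<in> span B \<Longrightarrow> orthogonal x y"
      using orthogonal_to_subspace_exists_gen by blast
    then have "x \<in> U" by (auto simp: U_def orthogonal_def inner_commute span_base)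
    with \<open>U = {0}\<close> \<open>x \<noteq> 0\<close> show False by simp
  qed
  then show thesis using that B ind by (auto simp: P_def)
qed

text \<open>The basis has as many elements as the index type, so it can be indexed by that type. The
  family \<open>d\<close> then lists the eigenvalues with repetition.\<close>

lemma symmetric_matrix_eigenbasis:
  fixes S :: "real ^ 'n ^ 'n"
  assumes S: "transpose S = S"
  obtains b :: "'n::finite \<Rightarrow> real ^ 'n" and d :: "'n \<Rightarrow> real"
  where "\<And>i j. b i \<bullet> b j = (if i = j then 1 else 0)"
    and "\<And>i. S *v b i = d i *\<^sub>R b i"
    and "\<And>x. x \<bullet> x = (\<Sum>i\<in>UNIV. (b i \<bullet> x)\<^sup>2)"
proof -
  have "(S *v x) \<bullet> y = x \<bullet> (S *v y)" for x y
    using dot_lmul_matrix[of x S y] S by (metis transpose_matrix_vector)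
  from selfadjoint_orthonormal_eigenbasis[OF matrix_vector_mul_linear this]
  obtain B where B: "pairwise orthogonal B" "\<And>v. v \<in> B \<Longrightarrow> norm v = 1"
    "\<And>v. v \<in> B \<Longrightarrow> \<exists>c. S *v v = c *\<^sub>R v" "independent B" "span B = UNIV" by metis
  have fin: "finite B" using B(4) independent_bound by blast
  have "card B = DIM(real ^ 'n)"
    using B(4,5) by (metis dim_UNIV dim_span dim_span_eq_card_independent)
  then have "card (UNIV::'n set) = card B" by simp
  then obtain b where b: "bij_betw b (UNIV::'n set) B"
    using fin by (metis finite_same_card_bij finite_class.finite_UNIV)
  have bB: "b i \<in> B" for i using b by (auto simp: bij_betw_def)
  have inj: "b i = b j \<longleftrightarrow> i = j" for i j using b by (auto simp: bij_betw_def inj_def)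
  have 1: "b i \<bullet> b j = (if i = j then 1 else 0)" for i j
    using B(1) B(2)[OF bB[of i]] bB inj by (auto simp: pairwise_def orthogonal_def norm_eq_1)
  obtain d where 2: "\<And>i. S *v b i = d i *\<^sub>R b i" using B(3)[OF bB] by metis
  have 3: "x \<bullet> x = (\<Sum>i\<in>UNIV. (b i \<bullet> x)\<^sup>2)" for x
  proof -
    have "x = (\<Sum>v\<in>B. (v \<bullet> x) *\<^sub>R v)"
      using orthonormal_basis_expand[OF B(1) _ _ fin, of x] B(2,5) by (simp add: inner_commute)
    also have "\<dots> = (\<Sum>i\<in>UNIV. (b i \<bullet> x) *\<^sub>R b i)"
      by (rule sum.reindex_bij_betw[OF b, symmetric])
    finally have "x \<bullet> x = (\<Sum>i\<in>UNIV. (b i \<bullet> x) *\<^sub>R b i) \<bullet> x" by simp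
    then show ?thesis by (simp add: inner_sum_left power2_eq_square)
  qed
  show thesis using that 1 2 3 by blast
qed

section \<open>Characteristic polynomial and multiplicities\<close>

lemma poly_charpoly: "poly (charpoly A) x = det (mat x - A)"
  unfolding charpoly_def det_def
  by (auto simp: poly_sum poly_prod mat_def of_int_poly intro!: sum.cong prod.cong)

text \<open>The orthogonal matrix with rows \<open>b i\<close> conjugates \<open>mat x - S\<close>
  into a diagonal matrix. Comparing determinants at every real \<open>x\<close> identifies the
  polynomials.\<close>

lemma charpoly_eigenbasis:
  fixes S :: "real ^ 'n::finite ^ 'n" and b :: "'n \<Rightarrow> real ^ 'n"
  assumes orth: "\<And>i j. b i \<bullet> b j = (if i = j then 1 else 0)"
    and eig: "\<And>i. S *v b i = d i *\<^sub>R b i"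
  shows "charpoly S = (\<Prod>i\<in>UNIV. [:- d i, 1:])"
proof -
  have "poly (charpoly S) x = poly (\<Prod>i\<in>UNIV. [:- d i, 1:]) x" for x
  proof -
    define V where "V = (\<chi> i. b i)"
    have VV: "V ** transpose V = mat 1"
      by (simp add: vec_eq_iff matrix_matrix_mult_def transpose_def V_def mat_def
          orth[unfolded inner_vec_def inner_real_def])
    have "(V ** ((mat x - S) ** transpose V)) $ i $ j = (if i = j then x - d i else 0)" for i j
    proof -
      have "(V ** ((mat x - S) ** transpose V)) $ i $ j = b i \<bullet> ((mat x - S) *v b j)"
        by (simp add: matrix_matrix_mult_def matrix_vector_mult_def inner_vec_def V_def transpose_def)
      also have "(mat x - S) *v b j = x *\<^sub>R b j - S *v b j"
        by (simp add: matrix_vector_mult_diff_rdistrib)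
          (simp add: vec_eq_iff matrix_vector_mult_def mat_def if_distrib[where f="\<lambda>a. a * _"] cong: if_cong)
      finally show ?thesis by (simp add: eig inner_diff_right orth)
    qed
    then have "det (V ** ((mat x - S) ** transpose V)) = (\<Prod>i\<in>UNIV. x - d i)"
      by (subst det_diagonal) auto
    moreover have "det V * det (transpose V) = 1"
      by (metis VV det_mul det_I)
    ultimately have "det (mat x - S) = (\<Prod>i\<in>UNIV. x - d i)"
      by (metis det_mul mult.assoc mult.commute mult.right_neutral)
    then show ?thesis by (simp add: poly_charpoly poly_prod)
  qed
  then show ?thesis by (simp add: poly_eq_poly_eq_iff[symmetric] fun_eq_iff)
qed

text \<open>Orders add up over a product of nonzero polynomials; this turns algebraic multiplicity
  into a count of indices.\<close>

lemma order_prod_linear: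
  fixes d :: "'n \<Rightarrow> real"
  assumes "finite I"
  shows "order l (\<Prod>i\<in>I. [:- d i, 1:]) = card {i \<in> I. d i = l}"
  using assms
proof (induction I rule: finite_induct)
  case (insert i I)
  have "order l [:- d i, 1:] = (if d i = l then 1 else 0)"
    using order_power_n_n[of l 1] by (auto intro!: order_0I)
  moreover have "{j \<in> insert i I. d j = l} = (if d i = l then insert i {j \<in> I. d j = l} else {j \<in> I. d j = l})"
    by auto
  moreover have "order l (\<Prod>j\<in>insert i I. [:- d j, 1:]) = order l [:- d i, 1:] + order l (\<Prod>j\<in>I. [:- d j, 1:])"
    unfolding prod.insert[OF insert.hyps] using insert.hyps by (intro order_mult) (simp del: mult_pCons_left)
  ultimately show ?case using insert by simp
qed simp

section \<open>Laplace transforms\<close>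

text \<open>With \<open>y = exp (- x)\<close> the half-line becomes the interval from 0 to 1, and
  the transform at the integers gives the moments of \<open>y\<close>.\<close>

lemma laplace_determines_bounded_continuous:
  fixes \<mu> \<nu> :: "real measure" and F :: "real \<Rightarrow> real"
  assumes \<mu>: "prob_space \<mu>" "sets \<mu> = sets borel" "AE x in \<mu>. 0 \<le> x"
    and \<nu>: "prob_space \<nu>" "sets \<nu> = sets borel" "AE x in \<nu>. 0 \<le> x"
    and eq: "\<And>k::nat. (\<integral>x. exp (- (real k * x)) \<partial>\<mu>) = (\<integral>x. exp (- (real k * x)) \<partial>\<nu>)"
    and F: "continuous_on UNIV F" "bounded (range F)"
  shows "(\<integral>x. F x \<partial>\<mu>) = (\<integral>x. F x \<partial>\<nu>)"
proof -
  define good :: "real measure \<Rightarrow> bool" where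
    "good \<eta> \<longleftrightarrow> prob_space \<eta> \<and> sets \<eta> = sets borel \<and> (AE x in \<eta>. 0 \<le> x)" for \<eta>
  have g: "good \<mu>" "good \<nu>" using \<mu> \<nu> by (auto simp: good_def)
  have int_exp: "integrable \<eta> (\<lambda>x. exp (- (real k * x)))" if "good \<eta>" for k \<eta>
  proof -
    interpret prob_space \<eta> using that by (simp add: good_def)
    have [measurable_cong]: "sets \<eta> = sets borel" using that by (simp add: good_def)
    have "AE x in \<eta>. 0 \<le> x" using that by (simp add: good_def)
    then have "AE x in \<eta>. norm (exp (- (real k * x))) \<le> 1" by eventually_elim simp
    then show ?thesis by (rule integrable_const_bound) simp
  qed
  have poly: "integrable \<eta> (\<lambda>x. \<Sum>i\<le>n. a i * exp (- x) ^ i) \<and>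
      (\<integral>x. (\<Sum>i\<le>n. a i * exp (- x) ^ i) \<partial>\<eta>) = (\<Sum>i\<le>n. a i * (\<integral>x. exp (- (real i * x)) \<partial>\<eta>))"
    if "good \<eta>" for \<eta> n and a :: "nat \<Rightarrow> real"
    using int_exp[OF that] by (simp add: exp_of_nat_mult[symmetric])
  \<comment> \<open>Almost surely \<open>exp (- x)\<close> lies in \<open>{0..1}\<close>, where a
    polynomial is uniformly within \<open>e\<close> of \<open>h\<close>. Each of the two integrals
    changes by at most \<open>e\<close>, and the polynomial integrals agree.\<close>
  have weier: "(\<integral>x. h (exp (- x)) \<partial>\<mu>) = (\<integral>x. h (exp (- x)) \<partial>\<nu>)"
    if h: "continuous_on UNIV h" for h :: "real \<Rightarrow> real"
  proof -
    have "\<bar>(\<integral>x. h (exp (- x)) \<partial>\<mu>) - (\<integral>x. h (exp (- x)) \<partial>\<nu>)\<bar> \<le> 2 * e" if e: "e > 0" for e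
    proof -
      obtain p where "real_polynomial_function p" and p: "\<And>y. y \<in> {0..1} \<Longrightarrow> \<bar>h y - p y\<bar> < e"
        using Stone_Weierstrass_real_polynomial_function[of "{0..1}" h e] e h
        by (auto intro: continuous_on_subset)
      then obtain a n where pa: "p = (\<lambda>x. \<Sum>i\<le>n. a i * x ^ i)"
        by (auto simp: real_polynomial_function_iff_sum)
      have approx: "\<bar>(\<integral>x. h (exp (- x)) \<partial>\<eta>) - (\<integral>x. p (exp (- x)) \<partial>\<eta>)\<bar> \<le> e" if "good \<eta>" for \<eta>
      proof -
        interpret prob_space \<eta> using that by (simp add: good_def)
        have [measurable_cong]: "sets \<eta> = sets borel" using that by (simp add: good_def)
        have [measurable]: "h \<in> borel_measurable borel" "p \<in> borel_measurable borel"
          using h by (auto simp: pa intro!: borel_measurable_continuous_onI continuous_intros)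
        have nn: "AE x in \<eta>. 0 \<le> x" using that by (simp add: good_def)
        then have ae: "AE x in \<eta>. norm (h (exp (- x)) - p (exp (- x))) \<le> e"
          by eventually_elim (auto intro!: less_imp_le[OF p])
        then have i1: "integrable \<eta> (\<lambda>x. h (exp (- x)) - p (exp (- x)))"
          by (rule integrable_const_bound) simp
        have i2: "integrable \<eta> (\<lambda>x. p (exp (- x)))" using poly[OF that] by (simp add: pa)
        have i3: "integrable \<eta> (\<lambda>x. h (exp (- x)))"
          using Bochner_Integration.integrable_add[OF i1 i2] by simp
        have "\<bar>(\<integral>x. h (exp (- x)) \<partial>\<eta>) - (\<integral>x. p (exp (- x)) \<partial>\<eta>)\<bar> = norm (\<integral>x. h (exp (- x)) - p (exp (- x)) \<partial>\<eta>)"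
          using i2 i3 by simp
        also have "\<dots> \<le> (\<integral>x. norm (h (exp (- x)) - p (exp (- x))) \<partial>\<eta>)"
          by (rule integral_norm_bound)
        also have "\<dots> \<le> (\<integral>x. e \<partial>\<eta>)" using i1 ae by (intro integral_mono_AE) auto
        finally show ?thesis by (simp add: prob_space)
      qed
      have "(\<integral>x. p (exp (- x)) \<partial>\<mu>) = (\<integral>x. p (exp (- x)) \<partial>\<nu>)"
        using poly[OF g(1), where n=n and a=a] poly[OF g(2), where n=n and a=a] eq by (simp add: pa)
      then show ?thesis using approx[OF g(1)] approx[OF g(2)] by linarith
    qed
    then have "\<bar>(\<integral>x. h (exp (- x)) \<partial>\<mu>) - (\<integral>x. h (exp (- x)) \<partial>\<nu>)\<bar> \<le> 0 + e" if "e > 0" for e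
      using that by (metis add_0 field_sum_of_halves half_gt_zero mult_2)
    then have "\<bar>(\<integral>x. h (exp (- x)) \<partial>\<mu>) - (\<integral>x. h (exp (- x)) \<partial>\<nu>)\<bar> \<le> 0"
      by (rule field_le_epsilon)
    then show ?thesis by simp
  qed
  \<comment> \<open>As a function of \<open>y\<close>, \<open>F (- ln y)\<close> may have no limit
    at 0. Cutting \<open>y\<close> off below at \<open>exp (- k)\<close> restores continuity and
    amounts to replacing \<open>x\<close> by \<open>min x k\<close>.\<close>
  have trunc: "(\<integral>x. F (min x (real k)) \<partial>\<mu>) = (\<integral>x. F (min x (real k)) \<partial>\<nu>)" for k
  proof -
    have "continuous_on UNIV (\<lambda>y. F (- ln (max y (exp (- real k)))))"
    proof (rule continuous_on_compose2[OF F(1)])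
      have "max y (exp (- real k)) \<noteq> 0" for y
        using exp_gt_zero[of "- real k"] by (auto simp: max_def simp del: exp_gt_zero)
      then show "continuous_on UNIV (\<lambda>y. - ln (max y (exp (- real k))))" 
        by (intro continuous_intros) auto
    qed auto
    moreover have "- ln (max (exp (- x)) (exp (- real k))) = min x (real k)" for x
      by (auto simp: max_def min_def)
    ultimately show ?thesis using weier[of "\<lambda>y. F (- ln (max y (exp (- real k))))"] by simp
  qed
  obtain C where C: "\<And>x. norm (F x) \<le> C" using F(2) by (auto simp: bounded_iff)
  have lim: "(\<lambda>k. \<integral>x. F (min x (real k)) \<partial>\<eta>) \<longlonglongrightarrow> (\<integral>x. F x \<partial>\<eta>)" if "good \<eta>" for \<eta>
  proof (rule integral_dominated_convergence[where w="\<lambda>_. C"])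
    interpret prob_space \<eta> using that by (simp add: good_def)
    have [measurable_cong]: "sets \<eta> = sets borel" using that by (simp add: good_def)
    have [measurable]: "F \<in> borel_measurable borel" using F(1) by (rule borel_measurable_continuous_onI)
    show "F \<in> borel_measurable \<eta>" "\<And>k. (\<lambda>x. F (min x (real k))) \<in> borel_measurable \<eta>" by measurable
    show "integrable \<eta> (\<lambda>_. C)" by simp
    show "AE x in \<eta>. (\<lambda>k. F (min x (real k))) \<longlonglongrightarrow> F x"
    proof (rule AE_I2)
      fix x :: real
      obtain K :: nat where "x \<le> real K" using real_arch_simple by blast
      then have "F (min x (real k)) = F x" if "k \<ge> K" for k using that by (simp add: min_def)
      then show "(\<lambda>k. F (min x (real k))) \<longlonglongrightarrow> F x"
        by (intro tendsto_eventually eventually_sequentiallyI)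
    qed
    show "\<And>k. AE x in \<eta>. norm (F (min x (real k))) \<le> C" using C by simp
  qed
  show ?thesis using LIMSEQ_unique[OF lim[OF g(1)]] lim[OF g(2)] trunc by simp
qed

section \<open>Chi-square laws and the law of \<open>Q\<close>\<close>

text \<open>Substitution \<open>b * t\<close> in Euler's integral. The nonnegative integral yields
  the value and finiteness together.\<close>

lemma nn_integral_gamma:
  fixes a b :: real
  assumes a: "a > 0" and b: "b > 0"
  shows "(\<integral>\<^sup>+t. ennreal (indicator {0..} t * t powr (a - 1) * exp (- (b * t))) \<partial>lborel) = ennreal (Gamma a / b powr a)"
    (is "?I = _")
proof -
  have "ennreal (Gamma a) = ennreal \<bar>b\<bar> * (\<integral>\<^sup>+t. ennreal (indicator {0..} (0 + b * t) * (0 + b * t) powr (a - 1) / exp (0 + b * t)) \<partial>lborel)"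
    unfolding Gamma_conv_nn_integral_real[OF a] using b by (intro nn_integral_real_affine) auto
  also have "(\<integral>\<^sup>+t. ennreal (indicator {0..} (0 + b * t) * (0 + b * t) powr (a - 1) / exp (0 + b * t)) \<partial>lborel)
     = (\<integral>\<^sup>+t. ennreal (b powr (a - 1)) * ennreal (indicator {0..} t * t powr (a - 1) * exp (- (b * t))) \<partial>lborel)"
    using b by (intro nn_integral_cong)
      (auto simp: ennreal_mult[symmetric] indicator_def powr_mult exp_minus field_simps zero_le_mult_iff)
  also have "\<dots> = ennreal (b powr (a - 1)) * ?I" by (rule nn_integral_cmult) auto
  also have "ennreal \<bar>b\<bar> * (ennreal (b powr (a - 1)) * ?I) = ennreal (b powr a) * ?I"
  proof -
    have "b * b powr (a - 1) = b powr a" using b by (simp add: powr_mult_base)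
    then show ?thesis using b by (simp add: mult.assoc[symmetric] ennreal_mult[symmetric])
  qed
  finally have "ennreal (Gamma a / b powr a) = ennreal (b powr a) * ?I / ennreal (b powr a)"
    using b a by (simp add: divide_ennreal[symmetric] Gamma_real_pos less_imp_le)
  also have "\<dots> = ?I" using b ennreal_mult_divide_eq[of "ennreal (b powr a)" ?I] by (subst mult.commute) simp
  finally show ?thesis by simp
qed

lemma chi2_density_nonneg: "0 \<le> chi2_density r x"
  \<comment> \<open>For \<open>r = 0\<close> both \<open>Gamma 0\<close> and division by zero take
    the value 0, so the density vanishes identically.\<close>
  by (cases "r = 0") (auto simp: chi2_density_def intro!: divide_nonneg_nonneg mult_nonneg_nonneg less_imp_le[OF Gamma_real_pos])

lemma borel_measurable_chi2_density [measurable]: "chi2_density r \<in> borel_measurable borel"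
  unfolding chi2_density_def[abs_def] by measurable

text \<open>Multiplying by \<open>exp (- (s * x))\<close> only changes the rate of this gamma
  density from \<open>1/2\<close> to \<open>s + 1/2\<close>. The case \<open>s = 0\<close> gives
  total mass one.\<close>

lemma nn_integral_chi2_exp:
  assumes r: "r > 0" and s: "s \<ge> 0"
  shows "(\<integral>\<^sup>+x. ennreal (exp (- (s * x))) \<partial>density lborel (chi2_density r)) = ennreal ((1 + 2 * s) powr (- (real r / 2)))"
proof -
  define a where "a = real r / 2"
  have a: "a > 0" using r by (simp add: a_def)
  have G: "Gamma a > 0" using a by (rule Gamma_real_pos)
  have "(\<integral>\<^sup>+x. ennreal (exp (- (s * x))) \<partial>density lborel (chi2_density r))
     = (\<integral>\<^sup>+x. ennreal (chi2_density r x) * ennreal (exp (- (s * x))) \<partial>lborel)"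
    by (subst nn_integral_density) auto
  also have "\<dots> = (\<integral>\<^sup>+x. ennreal (1 / (2 powr a * Gamma a)) * ennreal (indicator {0..} x * x powr (a - 1) * exp (- ((s + 1/2) * x))) \<partial>lborel)"
  proof (rule nn_integral_cong)
    fix x :: real
    have "chi2_density r x * exp (- (s * x)) = 1 / (2 powr a * Gamma a) * (indicator {0..} x * x powr (a - 1) * exp (- ((s + 1/2) * x)))"
      by (cases "x > 0"; cases "x = 0")
        (auto simp: chi2_density_def a_def[symmetric] field_simps exp_add[symmetric] exp_minus indicator_def)
    then show "ennreal (chi2_density r x) * ennreal (exp (- (s * x))) = ennreal (1 / (2 powr a * Gamma a)) * ennreal (indicator {0..} x * x powr (a - 1) * exp (- ((s + 1/2) * x)))"
      using G by (simp add: ennreal_mult[symmetric] chi2_density_nonneg)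
  qed
  also have "\<dots> = ennreal (1 / (2 powr a * Gamma a)) * ennreal (Gamma a / (s + 1/2) powr a)"
    using a s by (subst nn_integral_cmult) (auto simp: nn_integral_gamma)
  also have "\<dots> = ennreal (1 / (2 powr a * Gamma a) * (Gamma a / (s + 1/2) powr a))"
    using G by (intro ennreal_mult[symmetric]) auto
  also have "1 / (2 powr a * Gamma a) * (Gamma a / (s + 1/2) powr a) = 1 / (2 powr a * (s + 1/2) powr a)"
    using G by simp
  also have "2 powr a * (s + 1/2) powr a = (1 + 2 * s) powr a"
    using s by (subst powr_mult[symmetric]) (auto simp: algebra_simps)
  finally show ?thesis by (simp add: powr_minus_divide a_def)
qed

lemma prob_space_chi2: "r > 0 \<Longrightarrow> prob_space (density lborel (chi2_density r))"
  using nn_integral_chi2_exp[of r 0] by (intro prob_spaceI) simp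

lemma integral_chi2_exp:
  assumes r: "r > 0" and s: "s \<ge> 0"
  shows "(\<integral>x. exp (- (s * x)) \<partial>density lborel (chi2_density r)) = (1 + 2 * s) powr (- (real r / 2))"
    and "integrable (density lborel (chi2_density r)) (\<lambda>x. exp (- (s * x)))"
  using nn_integral_chi2_exp[OF r s]
  by (auto simp: integral_eq_nn_integral integrable_iff_bounded)

lemma AE_chi2_nonneg: "AE x in density lborel (chi2_density r). 0 \<le> x"
  by (subst AE_density) (auto simp: chi2_density_def)

text \<open>Independence factorizes the Laplace transform. Positive eigenvalues keep every argument
  \<open>s * l\<close> nonnegative, as the chi-square transform requires, and make the sum
  nonnegative.\<close>

lemma
  fixes A :: "real ^ 'd::finite ^ 'd"
  defines "\<Lambda> \<equiv> {l. l \<noteq> 0 \<and> poly (charpoly A) l = 0}"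
  assumes nz: "charpoly A \<noteq> 0" and pos: "\<And>l. l \<in> \<Lambda> \<Longrightarrow> l > 0"
  shows prob_space_Q_law: "prob_space (Q_law A)"
    and AE_Q_law_nonneg: "AE q in Q_law A. 0 \<le> q"
    and laplace_Q_law: "s \<ge> 0 \<Longrightarrow> (\<integral>q. exp (- (s * q)) \<partial>Q_law A)
      = (\<Prod>l\<in>\<Lambda>. (1 + 2 * s * l) powr (- (real (order l (charpoly A)) / 2)))"
proof -
  have fin: "finite \<Lambda>"
    using poly_roots_finite[OF nz] by (auto simp: \<Lambda>_def intro: finite_subset[rotated])
  \<comment> \<open>A product of probability spaces asks for a probability measure at every index.
    Outside \<open>\<Lambda>\<close> the order can be 0, where the chi-square density has no mass,
    so a point mass fills in.\<close>
  define D where "D l = (if l \<in> \<Lambda> then density lborel (chi2_density (order l (charpoly A))) else return borel 0)" for l :: real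
  have ord: "order l (charpoly A) > 0" if "l \<in> \<Lambda>" for l
    using that nz by (auto simp: \<Lambda>_def order_gt_0_iff)
  have sD [measurable_cong]: "sets (D l) = sets borel" for l by (simp add: D_def)
  have pD: "prob_space (D l)" for l
    using prob_space_chi2 ord by (auto simp: D_def intro!: prob_space_return)
  interpret product_prob_space D \<Lambda> by (rule product_prob_spaceI) (rule pD)
  interpret P: prob_space "PiM \<Lambda> D" by (rule prob_space_PiM) (rule pD)
  have Q: "Q_law A = distr (PiM \<Lambda> D) borel (\<lambda>c. \<Sum>l\<in>\<Lambda>. l * c l)"
    unfolding Q_law_def Let_def \<Lambda>_def[symmetric]
    by (intro distr_cong PiM_cong) (auto simp: D_def)
  have meas [measurable]: "(\<lambda>c. \<Sum>l\<in>\<Lambda>. l * c l) \<in> borel_measurable (PiM \<Lambda> D)" by measurable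
  show "prob_space (Q_law A)" unfolding Q by (rule P.prob_space_distr) measurable
  have "AE c in PiM \<Lambda> D. \<forall>l\<in>\<Lambda>. 0 \<le> c l"
  proof (rule AE_finite_allI[OF fin])
    fix l assume l: "l \<in> \<Lambda>"
    have "AE x in D l. 0 \<le> x" using AE_chi2_nonneg[of "order l (charpoly A)"] l by (simp only: D_def if_True)
    then show "AE c in PiM \<Lambda> D. 0 \<le> c l" using l pD by (intro AE_PiM_component) auto
  qed
  then have "AE c in PiM \<Lambda> D. 0 \<le> (\<Sum>l\<in>\<Lambda>. l * c l)"
    by eventually_elim (auto intro!: sum_nonneg mult_nonneg_nonneg intro: less_imp_le[OF pos])
  then show "AE q in Q_law A. 0 \<le> q" unfolding Q by (subst AE_distr_iff) auto
  assume s: "s \<ge> 0"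
  have "(\<integral>q. exp (- (s * q)) \<partial>Q_law A) = (\<integral>c. exp (- (s * (\<Sum>l\<in>\<Lambda>. l * c l))) \<partial>PiM \<Lambda> D)"
    unfolding Q by (subst integral_distr) auto
  also have "\<dots> = (\<integral>c. (\<Prod>l\<in>\<Lambda>. exp (- (s * l * c l))) \<partial>PiM \<Lambda> D)"
    using fin by (simp add: exp_sum[symmetric] sum_negf sum_distrib_left mult.assoc)
  also have "\<dots> = (\<Prod>l\<in>\<Lambda>. \<integral>x. exp (- (s * l * x)) \<partial>D l)"
    using fin s ord
    by (intro product_integral_prod)
      (auto simp: D_def intro!: integral_chi2_exp(2) mult_nonneg_nonneg intro: less_imp_le[OF pos])
  also have "\<dots> = (\<Prod>l\<in>\<Lambda>. (1 + 2 * s * l) powr (- (real (order l (charpoly A)) / 2)))"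
  proof (rule prod.cong[OF refl])
    fix l assume l: "l \<in> \<Lambda>"
    have "0 \<le> s * l" using s pos[OF l] by simp
    from integral_chi2_exp(1)[OF ord[OF l] this] l
    show "(\<integral>x. exp (- (s * l * x)) \<partial>D l) = (1 + 2 * s * l) powr (- (real (order l (charpoly A)) / 2))"
      by (simp add: D_def mult.assoc)
  qed
  finally show "(\<integral>q. exp (- (s * q)) \<partial>Q_law A) = (\<Prod>l\<in>\<Lambda>. (1 + 2 * s * l) powr (- (real (order l (charpoly A)) / 2)))" .
qed

section \<open>The squared norm of a centered normal vector\<close>

text \<open>The product of the two exponentials is \<open>\<sigma>\<close> times the centered normal
  density of variance \<open>1 / (1 + 2 * a)\<close>, and that density has mass one.\<close>

lemma
  assumes a: "a \<ge> 0"
  shows integral_std_normal_exp_square: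
      "(\<integral>x. exp (- (a * x\<^sup>2)) \<partial>std_normal_distribution) = (1 + 2 * a) powr (- (1/2))"
    and integrable_std_normal_exp_square:
      "integrable std_normal_distribution (\<lambda>x. exp (- (a * x\<^sup>2)))"
proof -
  define \<sigma> where "\<sigma> = (1 + 2 * a) powr (- (1/2))"
  have \<sigma>: "\<sigma> > 0" using a by (simp add: \<sigma>_def)
  have "\<sigma>\<^sup>2 = (1 + 2 * a) powr (- 1)"
    unfolding \<sigma>_def power2_eq_square powr_add[symmetric] by simp
  then have \<sigma>2: "\<sigma>\<^sup>2 = 1 / (1 + 2 * a)" using a by (simp add: powr_minus_divide)
  have eq: "std_normal_density x * exp (- (a * x\<^sup>2)) = \<sigma> * normal_density 0 \<sigma> x" for x
  proof -
    have "sqrt (2 * pi * \<sigma>\<^sup>2) = sqrt (2 * pi) * \<sigma>" using \<sigma> by (simp add: real_sqrt_mult)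
    then have "\<sigma> * normal_density 0 \<sigma> x = 1 / sqrt (2 * pi) * exp (- x\<^sup>2 / (2 * \<sigma>\<^sup>2))"
      using \<sigma> by (simp add: normal_density_def)
    also have "- x\<^sup>2 / (2 * \<sigma>\<^sup>2) = - x\<^sup>2 / 2 + - (a * x\<^sup>2)"
      unfolding \<sigma>2 using a by (simp add: field_simps)
    also have "1 / sqrt (2 * pi) * exp (- x\<^sup>2 / 2 + - (a * x\<^sup>2)) = std_normal_density x * exp (- (a * x\<^sup>2))"
      by (simp only: exp_add std_normal_density_def mult.assoc)
    finally show ?thesis ..
  qed
  show "(\<integral>x. exp (- (a * x\<^sup>2)) \<partial>std_normal_distribution) = (1 + 2 * a) powr (- (1/2))"
    using \<sigma> by (subst integral_density) (auto simp: eq \<sigma>_def[symmetric])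
  show "integrable std_normal_distribution (\<lambda>x. exp (- (a * x\<^sup>2)))"
    using \<sigma> by (subst integrable_density) (auto simp: eq)
qed

text \<open>A characteristic function has modulus at most one, so its Gaussian exponent cannot be
  positive.\<close>

lemma centered_normal_psd:
  assumes "centered_normal S \<mu>"
  shows "0 \<le> t \<bullet> (S *v t)"
proof -
  interpret prob_space \<mu> using assms by (simp add: centered_normal_def)
  have "norm (\<integral>x. cis (t \<bullet> x) \<partial>\<mu>) \<le> (\<integral>x. norm (cis (t \<bullet> x)) \<partial>\<mu>)" by (rule integral_norm_bound)
  then have "exp (- (t \<bullet> (S *v t)) / 2) \<le> 1"
    using assms by (simp add: centered_normal_def prob_space)
  then show ?thesis by simp
qed

text \<open>The Gaussian is its own Fourier transform: \<open>exp (- s * |x|\<^sup>2)\<close> is the expectation of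
  \<open>cis (T \<bullet> x)\<close> over a normal vector \<open>T\<close> with independent coordinates in the eigenbasis. Integrating
  over \<open>x\<close> first therefore only involves the characteristic function of \<open>\<mu>\<close>.\<close>
lemma laplace_norm_square_centered_normal:
  fixes S :: "real ^ 'n::finite ^ 'n" and b :: "'n \<Rightarrow> real ^ 'n"
  assumes normal: "centered_normal S \<mu>"
    and orth: "\<And>i j. b i \<bullet> b j = (if i = j then 1 else 0)"
    and eig: "\<And>i. S *v b i = d i *\<^sub>R b i"
    and parseval: "\<And>x. x \<bullet> x = (\<Sum>i\<in>UNIV. (b i \<bullet> x)\<^sup>2)"
    and d: "\<And>i. d i \<ge> 0" and s: "s \<ge> 0"
  shows "(\<integral>x. exp (- (s * (x \<bullet> x))) \<partial>\<mu>) = (\<Prod>i\<in>UNIV. (1 + 2 * s * d i) powr (- (1/2)))"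
proof -
  \<comment> \<open>With this scale the vector \<open>T g\<close> below has characteristic function
    \<open>exp (- (\<tau>^2 * |x|^2 / 2)) = exp (- (s * |x|^2))\<close>.\<close>
  define \<tau> where "\<tau> = sqrt (2 * s)"
  have \<tau>: "\<tau>\<^sup>2 = 2 * s" using s by (simp add: \<tau>_def)
  interpret \<mu>: prob_space \<mu> using normal by (simp add: centered_normal_def)
  have [measurable_cong]: "sets \<mu> = sets borel" using normal by (simp add: centered_normal_def)
  let ?N = "std_normal_distribution"
  interpret N: real_distribution ?N by (rule real_dist_normal_dist)
  define G where "G = PiM (UNIV :: 'n set) (\<lambda>_. ?N)"
  interpret product_prob_space "\<lambda>_. ?N" "UNIV :: 'n set"
    by (rule product_prob_spaceI) (rule N.prob_space_axioms)
  interpret G: prob_space G unfolding G_def by (rule prob_space_PiM) (rule N.prob_space_axioms)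
  interpret pair: pair_prob_space G \<mu> ..
  define T where "T g = \<tau> *\<^sub>R (\<Sum>i\<in>UNIV. g i *\<^sub>R b i)" for g :: "'n \<Rightarrow> real"
  have T [measurable]: "T \<in> borel_measurable G" unfolding T_def G_def by measurable
  have fourier: "complex_of_real (exp (- (s * (x \<bullet> x)))) = (\<integral>g. cis (T g \<bullet> x) \<partial>G)" for x
  proof -
    have "complex_of_real (exp (- (s * (x \<bullet> x)))) = (\<Prod>i\<in>UNIV. complex_of_real (exp (- (\<tau> * (b i \<bullet> x))\<^sup>2 / 2)))"
      unfolding parseval[of x]
      by (simp add: exp_sum[symmetric] of_real_prod[symmetric] sum_negf sum_distrib_left power_mult_distrib \<tau>
          del: of_real_prod)
    also have "\<dots> = (\<Prod>i\<in>UNIV. char ?N (\<tau> * (b i \<bullet> x)))" by (simp add: char_std_normal_distribution)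
    also have "\<dots> = (\<integral>g. (\<Prod>i\<in>UNIV. iexp (\<tau> * (b i \<bullet> x) * g i)) \<partial>G)"
      unfolding char_def G_def
      by (intro product_integral_prod[symmetric] N.integrable_const_bound[where B=1]) auto
    also have "(\<lambda>g. \<Prod>i\<in>UNIV. iexp (\<tau> * (b i \<bullet> x) * g i)) = (\<lambda>g. cis (T g \<bullet> x))"
      by (simp add: fun_eq_iff exp_sum[symmetric] cis_conv_exp T_def inner_sum_left sum_distrib_left mult_ac)
    finally show ?thesis .
  qed
  \<comment> \<open>The covariance form is diagonal in the eigenbasis, so the integral left over
    after exchanging the order splits into one-dimensional Gaussian integrals.\<close>
  have quad: "T g \<bullet> (S *v T g) = (\<Sum>i\<in>UNIV. 2 * s * d i * (g i)\<^sup>2)" for g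
  proof -
    have "S *v T g = \<tau> *\<^sub>R (\<Sum>i\<in>UNIV. (g i * d i) *\<^sub>R b i)"
      by (simp add: T_def eig linear_scale[OF matrix_vector_mul_linear] linear_sum[OF matrix_vector_mul_linear])
    moreover have "b i \<bullet> (\<Sum>j\<in>UNIV. (g j * d j) *\<^sub>R b j) = g i * d i" for i
      by (simp add: inner_sum_right orth if_distrib[where f="\<lambda>x. _ * x"] cong: if_cong)
    ultimately have "T g \<bullet> (S *v T g) = \<tau>\<^sup>2 * (\<Sum>i\<in>UNIV. g i * (g i * d i))"
      by (simp add: T_def inner_sum_left power2_eq_square)
    then show ?thesis unfolding \<tau> by (simp add: sum_distrib_left power2_eq_square mult_ac)
  qed
  have "complex_of_real (\<integral>x. exp (- (s * (x \<bullet> x))) \<partial>\<mu>) = (\<integral>x. (\<integral>g. cis (T g \<bullet> x) \<partial>G) \<partial>\<mu>)"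
    by (simp add: fourier[symmetric])
  also have "\<dots> = (\<integral>g. (\<integral>x. cis (T g \<bullet> x) \<partial>\<mu>) \<partial>G)"
  proof (rule pair.Fubini_integral)
    have "(\<lambda>p. iexp (T (fst p) \<bullet> snd p)) \<in> borel_measurable (G \<Otimes>\<^sub>M \<mu>)" by measurable
    then show "integrable (G \<Otimes>\<^sub>M \<mu>) (\<lambda>(g, x). cis (T g \<bullet> x))"
      by (intro pair.P.integrable_const_bound[where B=1]) (auto simp: cis_conv_exp case_prod_beta)
  qed
  also have "\<dots> = (\<integral>g. complex_of_real (\<Prod>i\<in>UNIV. exp (- (s * d i * (g i)\<^sup>2))) \<partial>G)"
    using normal by (simp add: centered_normal_def quad exp_sum[symmetric] sum_negf sum_divide_distrib mult_ac del: of_real_prod)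
  also have "\<dots> = complex_of_real (\<integral>g. (\<Prod>i\<in>UNIV. exp (- (s * d i * (g i)\<^sup>2))) \<partial>G)"
    by (rule integral_complex_of_real)
  also have "(\<integral>g. (\<Prod>i\<in>UNIV. exp (- (s * d i * (g i)\<^sup>2))) \<partial>G) = (\<Prod>i\<in>UNIV. \<integral>y. exp (- (s * d i * y\<^sup>2)) \<partial>?N)"
    unfolding G_def using s d by (intro product_integral_prod integrable_std_normal_exp_square) auto
  also have "\<dots> = (\<Prod>i\<in>UNIV. (1 + 2 * s * d i) powr (- (1/2)))"
    using s d by (intro prod.cong refl) (subst integral_std_normal_exp_square, auto simp: mult.assoc)
  finally show ?thesis using of_real_eq_iff by blast
qed

text \<open>The squared norm and \<open>Q\<close> have the same Laplace transform. Existence of the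
  normal law makes all eigenvalues nonnegative, so both live on the half-line.\<close>

lemma integral_norm_square_centered_normal:
  fixes S :: "real ^ 'n::finite ^ 'n" and F :: "real \<Rightarrow> real"
  assumes normal: "centered_normal S \<mu>" and sym: "transpose S = S"
    and F: "continuous_on UNIV F" "bounded (range F)"
  shows "(\<integral>x. F (x \<bullet> x) \<partial>\<mu>) = (\<integral>q. F q \<partial>Q_law S)"
proof -
  interpret \<mu>: prob_space \<mu> using normal by (simp add: centered_normal_def)
  have s\<mu> [measurable_cong]: "sets \<mu> = sets borel" using normal by (simp add: centered_normal_def)
  obtain b :: "'n \<Rightarrow> real ^ 'n" and d
    where orth: "\<And>i j. b i \<bullet> b j = (if i = j then 1 else 0)"
      and eig: "\<And>i. S *v b i = d i *\<^sub>R b i"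
      and parseval: "\<And>x. x \<bullet> x = (\<Sum>i\<in>UNIV. (b i \<bullet> x)\<^sup>2)"
    using symmetric_matrix_eigenbasis[OF sym] by blast
  have d: "d i \<ge> 0" for i
    using centered_normal_psd[OF normal, of "b i"] by (simp add: eig orth)
  have cp: "charpoly S = (\<Prod>i\<in>UNIV. [:- d i, 1:])" by (rule charpoly_eigenbasis[OF orth eig])
  then have nz: "charpoly S \<noteq> 0" by simp
  define \<Lambda> where "\<Lambda> = {l. l \<noteq> 0 \<and> poly (charpoly S) l = 0}"
  have \<Lambda>: "\<Lambda> = d ` UNIV - {0}" by (auto simp: \<Lambda>_def cp poly_prod)
  have pos: "l > 0" if "l \<in> \<Lambda>" for l using that d by (auto simp: \<Lambda> less_le)
  note Q = prob_space_Q_law[OF nz pos[unfolded \<Lambda>_def]] AE_Q_law_nonneg[OF nz pos[unfolded \<Lambda>_def]]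
    laplace_Q_law[OF nz pos[unfolded \<Lambda>_def]]
  \<comment> \<open>Equal eigenvalues are grouped, each group contributing its cardinality, which is
    the multiplicity, to the exponent. Zero eigenvalues contribute the factor 1 and drop
    out.\<close>
  have lap: "(\<Prod>i\<in>UNIV. (1 + 2 * s * d i) powr (- (1/2)))
      = (\<Prod>l\<in>\<Lambda>. (1 + 2 * s * l) powr (- (real (order l (charpoly S)) / 2)))" if "s \<ge> 0" for s
  proof -
    let ?h = "\<lambda>l. (1 + 2 * s * l) powr (- (1/2))"
    have "(\<Prod>i\<in>UNIV. ?h (d i)) = (\<Prod>l\<in>d ` UNIV. \<Prod>i\<in>{i\<in>UNIV. d i = l}. ?h (d i))"
      by (rule prod.image_gen) simp
    also have "\<dots> = (\<Prod>l\<in>d ` UNIV. ?h l ^ card {i. d i = l})"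
      by (intro prod.cong refl) simp
    also have "\<dots> = (\<Prod>l\<in>\<Lambda>. ?h l ^ card {i. d i = l})"
      by (rule prod.mono_neutral_right) (auto simp: \<Lambda>)
    also have "\<dots> = (\<Prod>l\<in>\<Lambda>. (1 + 2 * s * l) powr (- (real (order l (charpoly S)) / 2)))"
    proof (rule prod.cong[OF refl])
      fix l assume "l \<in> \<Lambda>"
      then have "0 < 1 + 2 * s * l" using pos \<open>s \<ge> 0\<close> by (simp add: add_pos_nonneg less_imp_le)
      then show "?h l ^ card {i. d i = l} = (1 + 2 * s * l) powr (- (real (order l (charpoly S)) / 2))"
        by (simp add: cp order_prod_linear powr_realpow[symmetric] powr_powr)
    qed
    finally show ?thesis .
  qed
  let ?\<nu> = "distr \<mu> borel (\<lambda>x. x \<bullet> x)"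
  have "(\<integral>q. F q \<partial>?\<nu>) = (\<integral>q. F q \<partial>Q_law S)"
  proof (rule laplace_determines_bounded_continuous)
    show "prob_space ?\<nu>" by (rule \<mu>.prob_space_distr) measurable
    show "AE q in ?\<nu>. 0 \<le> q" by (subst AE_distr_iff) auto
    show "sets (Q_law S) = sets borel" by (simp add: Q_law_def Let_def)
    fix k :: nat
    have "(\<integral>q. exp (- (real k * q)) \<partial>?\<nu>) = (\<integral>x. exp (- (real k * (x \<bullet> x))) \<partial>\<mu>)"
      by (subst integral_distr) auto
    also have "\<dots> = (\<Prod>i\<in>UNIV. (1 + 2 * real k * d i) powr (- (1/2)))"
      by (rule laplace_norm_square_centered_normal[OF normal orth eig parseval d]) auto
    finally show "(\<integral>q. exp (- (real k * q)) \<partial>?\<nu>) = (\<integral>q. exp (- (real k * q)) \<partial>Q_law S)"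
      using Q(3)[of "real k"] lap[of "real k"] by (simp add: \<Lambda>_def)
  qed (use Q F in auto)
  moreover have "F \<in> borel_measurable borel" using F(1) by (rule borel_measurable_continuous_onI)
  then have "(\<integral>q. F q \<partial>?\<nu>) = (\<integral>x. F (x \<bullet> x) \<partial>\<mu>)" by (subst integral_distr) auto
  ultimately show ?thesis by simp
qed

section \<open>Slutsky argument and entropy expansion\<close>

text \<open>Slutsky's lemma combined with continuous mapping. Error control on the events
  \<open>norm (W n \<omega>) \<le> K\<close> suffices, because convergence in law leaves little mass
  outside a large ball.\<close>

lemma tendsto_integral_perturbed:
  fixes W :: "nat \<Rightarrow> 'a \<Rightarrow> 'b::euclidean_space" and Z :: "nat \<Rightarrow> 'a \<Rightarrow> 'c::euclidean_space"
    and f :: "'c \<Rightarrow> real"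
  assumes M: "prob_space M" and [measurable]: "\<And>n. W n \<in> borel_measurable M" "\<And>n. Z n \<in> borel_measurable M"
    and \<mu>: "prob_space \<mu>" "sets \<mu> = sets borel" and conv: "conv_distr M W \<mu>"
    and h: "continuous_on UNIV h"
    and err: "\<And>K e. e > 0 \<Longrightarrow> \<forall>\<^sub>F n in sequentially. \<forall>\<omega>\<in>space M. norm (W n \<omega>) \<le> K \<longrightarrow> norm (Z n \<omega> - h (W n \<omega>)) \<le> e"
    and f: "continuous_on UNIV f" "bounded (range f)"
  shows "(\<lambda>n. \<integral>\<omega>. f (Z n \<omega>) \<partial>M) \<longlonglongrightarrow> (\<integral>x. f (h x) \<partial>\<mu>)"
proof -
  interpret M: prob_space M by fact
  interpret \<mu>: prob_space \<mu> by fact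
  have [measurable_cong]: "sets \<mu> = sets borel" by fact
  have [measurable]: "f \<in> borel_measurable borel" "h \<in> borel_measurable borel"
    using f h by (auto intro: borel_measurable_continuous_onI)
  obtain C where C0: "C > 0" and C: "\<And>x. \<bar>f x\<bar> \<le> C"
    using f(2) by (auto simp: bounded_pos)
  \<comment> \<open>A continuous substitute for the indicator of large norm: 0 up to
    \<open>K\<close> and 1 from \<open>K + 1\<close> on. Continuity lets its integrals pass to the
    limit law, which yields tightness.\<close>
  define \<phi> where "\<phi> K x = min 1 (max 0 (norm x - real K))" for K :: nat and x :: 'b
  have \<phi>c: "continuous_on UNIV (\<phi> K)" for K unfolding \<phi>_def by (intro continuous_intros)
  have [measurable]: "\<phi> K \<in> borel_measurable borel" for K using \<phi>c by (rule borel_measurable_continuous_onI)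
  have \<phi>b: "0 \<le> \<phi> K x" "\<phi> K x \<le> 1" for K x by (auto simp: \<phi>_def)
  have "(\<lambda>K. \<integral>x. \<phi> K x \<partial>\<mu>) \<longlonglongrightarrow> (\<integral>x. 0 \<partial>\<mu>)"
  proof (rule integral_dominated_convergence[where w="\<lambda>_. 1"])
    show "AE x in \<mu>. (\<lambda>K. \<phi> K x) \<longlonglongrightarrow> 0"
    proof (rule AE_I2)
      fix x :: 'b
      obtain k :: nat where "norm x \<le> real k" using real_arch_simple by blast
      then have "\<phi> K x = 0" if "K \<ge> k" for K using that by (simp add: \<phi>_def)
      then show "(\<lambda>K. \<phi> K x) \<longlonglongrightarrow> 0" by (intro tendsto_eventually eventually_sequentiallyI)
    qed
  qed (use \<phi>b in auto)
  then have \<phi>lim: "(\<lambda>K. \<integral>x. \<phi> K x \<partial>\<mu>) \<longlonglongrightarrow> 0" by simp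
  have cfh: "continuous_on UNIV (\<lambda>x. f (h x))" using continuous_on_compose2[OF f(1) h] by simp
  have bfh: "bounded (range (\<lambda>x. f (h x)))" using f(2) by (rule bounded_subset) auto
  have lim: "(\<lambda>n. \<integral>\<omega>. f (h (W n \<omega>)) \<partial>M) \<longlonglongrightarrow> (\<integral>x. f (h x) \<partial>\<mu>)"
    using conv cfh bfh unfolding conv_distr_def by blast
  have "(\<lambda>n. (\<integral>\<omega>. f (Z n \<omega>) \<partial>M) - (\<integral>\<omega>. f (h (W n \<omega>)) \<partial>M)) \<longlonglongrightarrow> 0"
  proof (rule tendstoI)
    fix \<eta> :: real assume \<eta>: "\<eta> > 0"
    \<comment> \<open>Makes the final bound \<open>e + 2 * C * e + e\<close> equal to
      \<open>\<eta>\<close>.\<close>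
    define e where "e = \<eta> / (2 + 2 * C)"
    have e: "e > 0" using \<eta> C0 by (simp add: e_def)
    obtain K where "\<forall>k\<ge>K. \<bar>(\<integral>x. \<phi> k x \<partial>\<mu>)\<bar> < e" using LIMSEQ_D[OF \<phi>lim e] by auto
    then have K: "(\<integral>x. \<phi> K x \<partial>\<mu>) < e" by force
    have "bounded (range (\<phi> K))" using \<phi>b by (auto simp: bounded_iff intro!: exI[of _ 1])
    then have "(\<lambda>n. \<integral>\<omega>. \<phi> K (W n \<omega>) \<partial>M) \<longlonglongrightarrow> (\<integral>x. \<phi> K x \<partial>\<mu>)"
      using conv \<phi>c by (simp add: conv_distr_def)
    then have ev1: "\<forall>\<^sub>F n in sequentially. (\<integral>\<omega>. \<phi> K (W n \<omega>) \<partial>M) < e"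
      using K by (rule order_tendstoD)
    have "compact (h ` cball 0 (real K + 1))"
      using h by (intro compact_continuous_image) (auto intro: continuous_on_subset)
    then obtain R where "\<forall>x\<in>cball 0 (real K + 1). norm (h x) \<le> R"
      by (auto dest!: compact_imp_bounded simp: bounded_iff)
    then have R: "norm (h x) \<le> R" if "norm x \<le> real K + 1" for x using that by simp
    have "uniformly_continuous_on (cball 0 (R + 1)) f"
      using f(1) by (intro compact_uniformly_continuous) (auto intro: continuous_on_subset)
    then obtain \<delta> where \<delta>: "\<delta> > 0"
      and uc: "\<And>x y. x \<in> cball 0 (R+1) \<Longrightarrow> y \<in> cball 0 (R+1) \<Longrightarrow> dist y x < \<delta> \<Longrightarrow> dist (f y) (f x) < e"
      using e unfolding uniformly_continuous_on_def by metis
    \<comment> \<open>The bound 1 keeps \<open>Z n \<omega>\<close> in the ball of radius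
      \<open>R + 1\<close>; half of \<open>\<delta>\<close> gives the strict inequality for uniform
      continuity.\<close>
    define \<delta>' where "\<delta>' = min 1 (\<delta> / 2)"
    have \<delta>': "\<delta>' > 0" using \<delta> by (simp add: \<delta>'_def)
    from err[OF \<delta>', of "real K + 1"] ev1
    show "\<forall>\<^sub>F n in sequentially. dist ((\<integral>\<omega>. f (Z n \<omega>) \<partial>M) - (\<integral>\<omega>. f (h (W n \<omega>)) \<partial>M)) 0 < \<eta>"
    proof eventually_elim
      case (elim n)
      \<comment> \<open>Inside the ball uniform continuity gives \<open>e\<close>; outside,
        \<open>\<phi>\<close> is 1 and the trivial bound \<open>2 * C\<close> applies.\<close>
      have pt: "\<bar>f (Z n \<omega>) - f (h (W n \<omega>))\<bar> \<le> e + 2 * C * \<phi> K (W n \<omega>)" if \<omega>: "\<omega> \<in> space M" for \<omega>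
      proof (cases "norm (W n \<omega>) \<le> real K + 1")
        case True
        with elim \<omega> have d: "norm (Z n \<omega> - h (W n \<omega>)) \<le> \<delta>'" by blast
        have "norm (Z n \<omega>) \<le> norm (h (W n \<omega>)) + norm (Z n \<omega> - h (W n \<omega>))"
          using norm_triangle_sub by blast
        then have "norm (Z n \<omega>) \<le> R + 1" using d R[OF True] by (simp add: \<delta>'_def)
        moreover have "dist (Z n \<omega>) (h (W n \<omega>)) < \<delta>" using d \<delta> by (simp add: dist_norm \<delta>'_def)
        ultimately have "dist (f (Z n \<omega>)) (f (h (W n \<omega>))) < e" using R[OF True] by (intro uc) auto
        moreover have "0 \<le> 2 * C * \<phi> K (W n \<omega>)" using C0 \<phi>b by simp
        ultimately show ?thesis unfolding dist_real_def by linarith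
      next
        case False
        then have "\<phi> K (W n \<omega>) = 1" by (simp add: \<phi>_def)
        then show ?thesis using C[of "Z n \<omega>"] C[of "h (W n \<omega>)"] e by (simp add: abs_le_iff)
      qed
      have i1: "integrable M (\<lambda>\<omega>. f (Z n \<omega>))" "integrable M (\<lambda>\<omega>. f (h (W n \<omega>)))"
        using C by (auto intro!: M.integrable_const_bound[where B=C])
      have i2: "integrable M (\<lambda>\<omega>. \<phi> K (W n \<omega>))"
        using \<phi>b by (auto intro!: M.integrable_const_bound[where B=1])
      have "\<bar>(\<integral>\<omega>. f (Z n \<omega>) \<partial>M) - (\<integral>\<omega>. f (h (W n \<omega>)) \<partial>M)\<bar> = \<bar>\<integral>\<omega>. f (Z n \<omega>) - f (h (W n \<omega>)) \<partial>M\<bar>"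
        using i1 by simp
      also have "\<dots> \<le> (\<integral>\<omega>. \<bar>f (Z n \<omega>) - f (h (W n \<omega>))\<bar> \<partial>M)" by (rule integral_abs_bound)
      also have "\<dots> \<le> (\<integral>\<omega>. e + 2 * C * \<phi> K (W n \<omega>) \<partial>M)"
        using i1 i2 pt by (intro integral_mono) auto
      also have "\<dots> = e + 2 * C * (\<integral>\<omega>. \<phi> K (W n \<omega>) \<partial>M)" using i2 by (simp add: M.prob_space)
      also have "\<dots> < e + 2 * C * e + e"
      proof -
        have "2 * C * (\<integral>\<omega>. \<phi> K (W n \<omega>) \<partial>M) \<le> 2 * C * e" using elim C0 by (intro mult_left_mono) auto
        then show ?thesis using e by linarith
      qed
      also have "\<dots> = e * (2 + 2 * C)" by (simp add: algebra_simps)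
      also have "\<dots> = \<eta>" using C0 by (simp add: e_def)
      finally show ?case by simp
    qed
  qed
  from tendsto_add[OF this lim] show ?thesis by simp
qed

section \<open>Second-order expansion of the entropy\<close>

text \<open>With \<open>y = N q - 1\<close> in each coordinate the entropy is \<open>ln N\<close>
  minus the mean of \<open>(1 + y) * ln (1 + y) = y + y^2 / 2 + o(y^2)\<close>. The linear terms
  cancel since \<open>q\<close> sums to one.\<close>

lemma shannon_expansion_uniform:
  assumes N: "fact m = real CARD('d)" and \<eta>: "\<eta> > 0"
  shows "\<exists>\<delta>>0. \<forall>q :: real ^ 'd::finite. (\<Sum>i\<in>UNIV. q $ i) = 1 \<longrightarrow> norm (q - unif m) \<le> \<delta> \<longrightarrow>
      \<bar>shannon q - ln (fact m) + fact m / 2 * (norm (q - unif m))\<^sup>2\<bar> \<le> \<eta> * (norm (q - unif m))\<^sup>2"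
proof -
  define N :: real where "N = fact m"
  have N0: "N > 0" by (simp add: N_def)
  define r where "r y = (1 + y) * ln (1 + y) - y - y\<^sup>2 / 2" for y :: real
  have "((\<lambda>y::real. ((1 + y) * ln (1 + y) - y - y\<^sup>2 / 2) / y\<^sup>2) \<longlongrightarrow> 0) (at 0)"
    by real_asymp
  then have "((\<lambda>y. r y / y\<^sup>2) \<longlongrightarrow> 0) (at 0)" by (simp add: r_def)
  from tendstoD[OF this, of "\<eta> / N"] obtain d where d: "d > 0" and dr: "\<And>y. y \<noteq> 0 \<Longrightarrow> \<bar>y\<bar> < d \<Longrightarrow> \<bar>r y / y\<^sup>2\<bar> < \<eta> / N"
    using \<eta> N0 by (auto simp: eventually_at dist_real_def)
  have r: "\<bar>r y\<bar> \<le> \<eta> / N * y\<^sup>2" if "\<bar>y\<bar> < d" for y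
  proof (cases "y = 0")
    case False
    then show ?thesis using dr[OF False that] by (simp add: abs_divide field_simps)
  qed (simp add: r_def)
  \<comment> \<open>Since \<open>y = N (q - u)\<close>, this keeps each \<open>y i\<close> below
    \<open>d\<close>, where the remainder bound holds, and below 1, so that all \<open>q $ i\<close>
    are positive.\<close>
  define \<delta> where "\<delta> = min (d / 2) (1 / 2) / N"
  have \<delta>: "\<delta> > 0" using d N0 by (simp add: \<delta>_def)
  have "\<bar>shannon q - ln N + N / 2 * (norm (q - unif m))\<^sup>2\<bar> \<le> \<eta> * (norm (q - unif m))\<^sup>2"
    if sum1: "(\<Sum>i\<in>UNIV. q $ i) = 1" and near: "norm (q - unif m) \<le> \<delta>" for q :: "real ^ 'd"
  proof -
    define y where "y i = N * q $ i - 1" for i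
    have y_eq: "y i = N * (q - unif m) $ i" for i
      using N0 by (simp add: y_def unif_def N_def right_diff_distrib)
    have ysmall: "\<bar>y i\<bar> < d" "\<bar>y i\<bar> < 1" for i
    proof -
      have "\<bar>(q - unif m) $ i\<bar> \<le> \<delta>" using component_le_norm_cart[of "q - unif m" i] near by linarith
      then have "\<bar>y i\<bar> \<le> N * \<delta>" using N0 by (simp add: y_eq abs_mult)
      then have "\<bar>y i\<bar> \<le> min (d / 2) (1 / 2)" using N0 by (simp add: \<delta>_def)
      then show "\<bar>y i\<bar> < d" "\<bar>y i\<bar> < 1" using d by auto
    qed
    have norm2: "(norm (q - unif m))\<^sup>2 = (\<Sum>i\<in>UNIV. (y i)\<^sup>2) / N\<^sup>2"
      using N0 by (simp add: power2_norm_eq_inner inner_vec_def y_eq power_mult_distrib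
          sum_distrib_left[symmetric] flip: power2_eq_square)
    have sumy: "(\<Sum>i\<in>UNIV. y i) = 0"
      using sum1 N by (simp add: y_def sum_subtractf sum_distrib_left[symmetric] N_def)
    have "shannon q = - (\<Sum>i\<in>UNIV. (1 + y i) * ln (1 + y i) / N - q $ i * ln N)"
      unfolding shannon_def
    proof (intro arg_cong[where f=uminus] sum.cong refl)
      fix i
      have "1 + y i > 0" using ysmall(2)[of i] by linarith
      then have qi: "q $ i > 0" using N0 by (simp add: y_def zero_less_mult_iff)
      then show "(if q $ i = 0 then 0 else q $ i * ln (q $ i)) = (1 + y i) * ln (1 + y i) / N - q $ i * ln N"
        using N0 by (simp add: y_def ln_mult field_simps)
    qed
    also have "\<dots> = ln N - (\<Sum>i\<in>UNIV. (1 + y i) * ln (1 + y i)) / N"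
      using sum1 by (simp add: sum_subtractf sum_divide_distrib sum_distrib_right[symmetric])
    also have "(\<Sum>i\<in>UNIV. (1 + y i) * ln (1 + y i)) = (\<Sum>i\<in>UNIV. y i + (y i)\<^sup>2 / 2 + r (y i))"
      by (simp add: r_def)
    also have "\<dots> = (\<Sum>i\<in>UNIV. (y i)\<^sup>2) / 2 + (\<Sum>i\<in>UNIV. r (y i))"
      by (simp add: sum.distrib sumy sum_divide_distrib)
    finally have "shannon q = ln N - ((\<Sum>i\<in>UNIV. (y i)\<^sup>2) / 2 + (\<Sum>i\<in>UNIV. r (y i))) / N" .
    moreover have "N / 2 * (norm (q - unif m))\<^sup>2 = (\<Sum>i\<in>UNIV. (y i)\<^sup>2) / 2 / N"
      using N0 unfolding norm2 by (simp add: power2_eq_square)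
    ultimately have "shannon q - ln N + N / 2 * (norm (q - unif m))\<^sup>2 = - (\<Sum>i\<in>UNIV. r (y i)) / N"
      by (simp add: add_divide_distrib)
    then have "\<bar>shannon q - ln N + N / 2 * (norm (q - unif m))\<^sup>2\<bar> = \<bar>\<Sum>i\<in>UNIV. r (y i)\<bar> / N"
      using N0 by (simp add: abs_divide)
    also have "\<dots> \<le> (\<Sum>i\<in>UNIV. \<eta> / N * (y i)\<^sup>2) / N"
      using N0 r ysmall(1) by (intro divide_right_mono order_trans[OF sum_abs] sum_mono) auto
    also have "\<dots> = \<eta> * (norm (q - unif m))\<^sup>2"
      using N0 unfolding norm2 by (simp add: sum_distrib_left[symmetric] sum_divide_distrib[symmetric] power2_eq_square)
    finally show ?thesis .
  qed
  then show ?thesis using \<delta> unfolding N_def by blast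
qed

section \<open>Measurability and relative frequencies\<close>

lemma insort_key_measurable:
  fixes X :: "nat \<Rightarrow> 'a \<Rightarrow> real"
  assumes [measurable]: "\<And>i. X i \<in> borel_measurable M"
  shows "(\<lambda>\<omega>. insort_key (\<lambda>i. X i \<omega>) a l) \<in> measurable M (count_space UNIV)"
proof (induction l)
  case (Cons y ys)
  note [measurable] = Cons
  show ?case by simp measurable
qed simp

text \<open>The sorted tail takes countably many values, so it is enough to treat insertion into
  each fixed list.\<close>

lemma sort_key_measurable:
  fixes X :: "nat \<Rightarrow> 'a \<Rightarrow> real"
  assumes X: "\<And>i. X i \<in> borel_measurable M"
  shows "(\<lambda>\<omega>. sort_key (\<lambda>i. X i \<omega>) l) \<in> measurable M (count_space UNIV)"
proof (induction l)
  case (Cons a l)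
  show ?case
    by simp (rule measurable_compose_countable[OF insort_key_measurable[OF X] Cons])
qed simp

lemma OPseq_measurable:
  assumes "\<And>t. X t \<in> borel_measurable M"
  shows "OPseq m X t \<in> measurable M (count_space UNIV)"
  unfolding OPseq_def[abs_def] ordpat_def using assms by (intro sort_key_measurable)

lemma phat_measurable:
  assumes "\<And>t. X t \<in> borel_measurable M"
  shows "phat m X pat n \<in> borel_measurable M"
proof -
  note [measurable] = OPseq_measurable[OF assms]
  have "(\<lambda>\<omega>. phat m X pat n \<omega> \<bullet> axis k 1) \<in> borel_measurable M" for k
    unfolding inner_axis phat_def by simp
  then show ?thesis
    by (subst borel_measurable_euclidean_space) (auto simp: Basis_vec_def)
qed

lemma shannon_measurable [measurable]: "shannon \<in> borel_measurable borel"
proof -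
  have [measurable]: "(\<lambda>q :: real ^ 'd. q $ k) \<in> borel_measurable borel" for k
    by (intro borel_measurable_continuous_onI continuous_intros)
  show "(shannon :: real ^ 'd \<Rightarrow> real) \<in> borel_measurable borel" unfolding shannon_def[abs_def] by measurable
qed

lemma OPseq_in_OPs: "OPseq m X t \<omega> \<in> OPs m"
  by (simp add: OPseq_def ordpat_def OPs_def)

text \<open>At every time exactly one pattern occurs. For \<open>n = 0\<close> division by zero
  would make all frequencies 0.\<close>

lemma sum_phat:
  assumes pat: "bij_betw pat UNIV (OPs m)" and n: "n > 0"
  shows "(\<Sum>i\<in>UNIV. phat m X pat n \<omega> $ i) = 1"
proof -
  have one: "(\<Sum>i\<in>UNIV. if OPseq m X t \<omega> = pat i then 1 else 0) = (1::real)" for t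
  proof -
    obtain j where j: "OPseq m X t \<omega> = pat j"
      using pat OPseq_in_OPs[of m X t \<omega>] by (auto simp: bij_betw_def)
    have "pat j = pat i \<longleftrightarrow> j = i" for i using pat by (auto simp: bij_betw_def inj_def)
    then show ?thesis by (simp add: j)
  qed
  have "(\<Sum>i\<in>UNIV. phat m X pat n \<omega> $ i) = (\<Sum>t\<in>{1..n}. \<Sum>i\<in>UNIV. if OPseq m X t \<omega> = pat i then 1 else 0) / real n"
    unfolding phat_def by (subst sum.swap) (simp add: sum_divide_distrib)
  then show ?thesis using n by (simp add: one)
qed

lemma card_OPs: "card (OPs m) = fact m"
proof -
  have "OPs m = permutations_of_set {0..<m}" by (auto simp: OPs_def permutations_of_set_def)
  then show ?thesis by simp
qed

lemma transpose_Sigma_mat: "transpose (Sigma_mat M m X pat) = Sigma_mat M m X pat"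
  by (simp add: transpose_def Sigma_mat_def vec_eq_iff sigma_term_def algebra_simps)

section \<open>Limit law\<close>

theorem theorem4p6:
  fixes M :: "'a measure" and X :: "nat \<Rightarrow> 'a \<Rightarrow> real" and m :: nat
    and pat :: "'d::finite \<Rightarrow> nat list"
  assumes "prob_space M"
    and "m \<ge> 2"
    and "\<And>t. X t \<in> borel_measurable M"
    and "bij_betw pat UNIV (OPs m)"
    and "stationary_seq M (OPseq m X)"
    and "\<And>i j. summable (\<lambda>k. \<bar>sigma_term M m X (pat i) (pat j) (Suc k)\<bar>)"
    and "\<exists>\<mu>. centered_normal (Sigma_mat M m X pat) \<mu> \<and>
           conv_distr M (\<lambda>n \<omega>. sqrt (real n) *\<^sub>R (phat m X pat n \<omega> - pvec M m X pat)) \<mu>"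
    and "pvec M m X pat = unif m"
  shows "conv_distr M
           (\<lambda>n \<omega>. (real n * (shannon (phat m X pat n \<omega>) - ln (fact m)),
                   real n * diseq m (phat m X pat n \<omega>)))
           (distr (Q_law (Sigma_mat M m X pat)) borel (\<lambda>q. (- (fact m / 2) * q, fact m / 8 * q)))"
proof -
  let ?S = "Sigma_mat M m X pat"
  define W where "W n \<omega> = sqrt (real n) *\<^sub>R (phat m X pat n \<omega> - unif m)" for n \<omega>
  define Z where "Z n \<omega> = (real n * (shannon (phat m X pat n \<omega>) - ln (fact m)),
                   real n * diseq m (phat m X pat n \<omega>))" for n \<omega>
  define g :: "real \<Rightarrow> real \<times> real" where "g q = (- (fact m / 2) * q, fact m / 8 * q)" for q
  define h :: "real ^ 'd \<Rightarrow> real \<times> real" where "h x = g (x \<bullet> x)" for x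
  obtain \<mu> where normal: "centered_normal ?S \<mu>" and conv: "conv_distr M W \<mu>"
    using assms(7) unfolding assms(8) W_def[abs_def] by blast
  have \<mu>: "prob_space \<mu>" "sets \<mu> = sets borel" using normal by (auto simp: centered_normal_def)
  have N: "fact m = real CARD('d)"
    using bij_betw_same_card[OF assms(4)] card_OPs[of m] by simp
  note [measurable] = phat_measurable[OF assms(3)]
  have [measurable]: "W n \<in> borel_measurable M" for n unfolding W_def[abs_def] by measurable
  have [measurable]: "Z n \<in> borel_measurable M" for n unfolding Z_def[abs_def] diseq_def by measurable
  have g: "continuous_on UNIV g" unfolding g_def by (intro continuous_intros)
  have h: "continuous_on UNIV h" unfolding h_def by (intro continuous_on_compose2[OF g] continuous_intros) auto
  \<comment> \<open>On \<open>norm (W n \<omega>) \<le> K\<close> the deviation from uniform is at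
    most \<open>K / sqrt n\<close>, so the expansion applies uniformly in \<open>\<omega>\<close>
    for large \<open>n\<close>. Multiplication by \<open>n\<close> turns its error into at most
    \<open>\<eta> * |W|^2\<close>.\<close>
  have err: "\<forall>\<^sub>F n in sequentially. \<forall>\<omega>\<in>space M. norm (W n \<omega>) \<le> K \<longrightarrow> norm (Z n \<omega> - h (W n \<omega>)) \<le> e"
    if e: "e > 0" for K e :: real
  proof -
    \<comment> \<open>The added 1 keeps \<open>L\<close> positive when \<open>K = 0\<close>;
      \<open>\<eta>\<close> is chosen so that the final bound \<open>2 * (\<eta> * L)\<close> is
      \<open>e\<close>.\<close>
    define L where "L = K\<^sup>2 + 1"
    have L0: "L > 0" by (simp add: L_def add_nonneg_pos)
    define \<eta> where "\<eta> = e / (2 * L)"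
    have \<eta>: "\<eta> > 0" using e L0 by (simp add: \<eta>_def)
    obtain \<delta> where \<delta>: "\<delta> > 0" and expansion:
      "\<And>q :: real ^ 'd. (\<Sum>i\<in>UNIV. q $ i) = 1 \<Longrightarrow> norm (q - unif m) \<le> \<delta> \<Longrightarrow>
        \<bar>shannon q - ln (fact m) + fact m / 2 * (norm (q - unif m))\<^sup>2\<bar> \<le> \<eta> * (norm (q - unif m))\<^sup>2"
      using shannon_expansion_uniform[OF N \<eta>] by blast
    have "(\<lambda>n. K / sqrt (real n)) \<longlonglongrightarrow> 0" by real_asymp
    from order_tendstoD(2)[OF this \<delta>] eventually_gt_at_top[of 0]
    show ?thesis
    proof eventually_elim
      case (elim n)
      show ?case
      proof (intro ballI impI)
        fix \<omega> assume "norm (W n \<omega>) \<le> K"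
        define q where "q = phat m X pat n \<omega>"
        define a where "a = (norm (W n \<omega>))\<^sup>2"
        \<comment> \<open>\<open>A\<close> and \<open>B\<close> are the scaled remainders at
          \<open>q\<close> and at the midpoint \<open>q'\<close>. The deviation is halved at
          \<open>q'\<close>, so the coefficient \<open>m!/2\<close> becomes \<open>m!/8\<close>
          there.\<close>
        define A where "A = real n * (shannon q - ln (fact m)) + fact m / 2 * a"
        define q' where "q' = (1/2) *\<^sub>R (q + unif m)"
        define B where "B = real n * (shannon q' - ln (fact m)) + fact m / 8 * a"
        have aK: "a \<le> K\<^sup>2" using \<open>norm (W n \<omega>) \<le> K\<close> by (simp add: a_def power_mono)
        have a: "a = real n * (norm (q - unif m))\<^sup>2"
          by (simp add: a_def W_def q_def power_mult_distrib)
        have "norm (q - unif m) = norm (W n \<omega>) / sqrt (real n)"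
          using elim by (simp add: W_def q_def)
        also have "\<dots> \<le> K / sqrt (real n)"
          using \<open>norm (W n \<omega>) \<le> K\<close> by (intro divide_right_mono) auto
        finally have near: "norm (q - unif m) \<le> \<delta>" using elim by linarith
        have sumq: "(\<Sum>i\<in>UNIV. q $ i) = 1" unfolding q_def using elim(2) by (rule sum_phat[OF assms(4)])
        have sumu: "(\<Sum>i\<in>UNIV. (unif m :: real ^ 'd) $ i) = 1" using N by (simp add: unif_def)
        have q'u: "q' - unif m = (1/2) *\<^sub>R (q - unif m)"
          by (simp add: q'_def scaleR_add_right scaleR_diff_right scaleR_left.add[symmetric] algebra_simps)
        have sumq': "(\<Sum>i\<in>UNIV. q' $ i) = 1"
          using sumq sumu by (simp add: q'_def sum_divide_distrib[symmetric] sum.distrib)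
        have nq': "norm (q' - unif m) = norm (q - unif m) / 2" by (simp add: q'u)
        have "A = real n * (shannon q - ln (fact m) + fact m / 2 * (norm (q - unif m))\<^sup>2)"
          unfolding A_def a by (simp only: distrib_left mult.left_commute)
        then have "\<bar>A\<bar> = real n * \<bar>shannon q - ln (fact m) + fact m / 2 * (norm (q - unif m))\<^sup>2\<bar>"
          by (simp add: abs_mult)
        also have "\<dots> \<le> real n * (\<eta> * (norm (q - unif m))\<^sup>2)"
          by (intro mult_left_mono expansion sumq near) auto
        finally have A: "\<bar>A\<bar> \<le> \<eta> * a" by (simp add: a mult_ac)
        have "B = real n * (shannon q' - ln (fact m) + fact m / 2 * (norm (q' - unif m))\<^sup>2)"
          unfolding B_def a nq' by (simp add: distrib_left power_divide)
        then have "\<bar>B\<bar> = real n * \<bar>shannon q' - ln (fact m) + fact m / 2 * (norm (q' - unif m))\<^sup>2\<bar>"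
          by (simp add: abs_mult)
        also have "\<dots> \<le> real n * (\<eta> * (norm (q' - unif m))\<^sup>2)"
          using near \<delta> by (intro mult_left_mono expansion sumq') (simp_all add: nq')
        finally have B: "\<bar>B\<bar> \<le> \<eta> * a / 4" unfolding nq' by (simp add: a power_divide mult_ac)
        have "W n \<omega> \<bullet> W n \<omega> = a" by (simp add: a_def power2_norm_eq_inner)
        \<comment> \<open>In the disequilibrium the quadratic coefficients combine to
          \<open>- m!/8 + m!/4 = m!/8\<close> and the logarithms cancel, leaving the remainder
          \<open>B - A / 2\<close>.\<close>
        then have "Z n \<omega> - h (W n \<omega>) = (A, B - A / 2)"
          unfolding Z_def h_def g_def A_def B_def diseq_def q_def[symmetric] q'_def[symmetric]
          by (simp add: field_simps)
        then have "norm (Z n \<omega> - h (W n \<omega>)) \<le> \<bar>A\<bar> + \<bar>B - A / 2\<bar>"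
          using norm_Pair_le[of A "B - A / 2"] by simp
        also have "\<dots> \<le> 2 * (\<eta> * a)" using A B by linarith
        also have "\<dots> \<le> 2 * (\<eta> * L)" unfolding L_def using aK \<eta> by (intro mult_left_mono) auto
        also have "\<dots> = e" using L0 by (simp add: \<eta>_def)
        finally show "norm (Z n \<omega> - h (W n \<omega>)) \<le> e" .
      qed
    qed
  qed
  have "(\<lambda>n. \<integral>\<omega>. f (Z n \<omega>) \<partial>M) \<longlonglongrightarrow> (\<integral>p. f p \<partial>distr (Q_law ?S) borel g)"
    if f: "continuous_on UNIV f" "bounded (range f)" for f :: "real \<times> real \<Rightarrow> real"
  proof -
    have "(\<lambda>n. \<integral>\<omega>. f (Z n \<omega>) \<partial>M) \<longlonglongrightarrow> (\<integral>x. f (h x) \<partial>\<mu>)"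
      by (rule tendsto_integral_perturbed[OF assms(1) _ _ \<mu> conv h err f]) auto
    \<comment> \<open>The limit map \<open>h\<close> depends on \<open>x\<close> only through its
      squared norm, so its law under \<open>\<mu>\<close> is governed by \<open>Q\<close>.\<close>
    also have "(\<integral>x. f (h x) \<partial>\<mu>) = (\<integral>q. f (g q) \<partial>Q_law ?S)"
      unfolding h_def
    proof (rule integral_norm_square_centered_normal[OF normal transpose_Sigma_mat])
      show "continuous_on UNIV (\<lambda>q. f (g q))" using continuous_on_compose2[OF f(1) g] by simp
      show "bounded (range (\<lambda>q. f (g q)))" using f(2) by (rule bounded_subset) auto
    qed
    also have "\<dots> = (\<integral>p. f p \<partial>distr (Q_law ?S) borel g)"
    proof (rule integral_distr[symmetric])
      have "sets (Q_law ?S) = sets borel" by (simp add: Q_law_def Let_def)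
      then show "g \<in> measurable (Q_law ?S) borel"
        using borel_measurable_continuous_onI[OF g] measurable_cong_sets by blast
      show "f \<in> borel_measurable borel" using f(1) by (rule borel_measurable_continuous_onI)
    qed
    finally show ?thesis .
  qed
  then show ?thesis unfolding conv_distr_def Z_def g_def[abs_def] by blast
qed

end
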